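(* Let $n>1$ be an integer, and let $T$ be a tree with $n+1$ vertices $v_1,\ldots,v_{n+1}$ and $n$ edges $e_1,\ldots,e_n$, where $v_1$ and $v_{n+1}$ are two leaves of $T$, and $e_1$ and $e_n$ are the edges incident to the leaves $v_1$ and $v_{n+1}$ respectively. Assign to each edge $e$ of $T$ a weight $w(e)\in\mathbb{Z}$. Then $$\det\left[q^{d(v_{j+1},v_k)}-t\right]_{1\leq j,k\leq n}=t\,(q^{w(e_1)}-1)(q^{w(e_n)}-1)\prod_{1<i<n}(q^{2w(e_i)}-1).$$ In particular, $$\det\left[x+d_q(v_{j+1},v_k)\right]_{1\leq j,k\leq n}=((1-q)x+1)\,[w(e_1)]_q\,[w(e_n)]_q\prod_{1<i<n}[2w(e_i)]_q.$$
   Context: Here $q$, $t$, $x$ are variables (indeterminates). Trees are finite and undirected. A leaf of a tree is a vertex of degree one. For vertices $u,v$ of the weighted tree $T$, the weighted distance $d(u,v)\in\mathbb{Z}$ is the sum of the weights $w(e)$ of all edges $e$ in the unique path from $u$ to $v$ in $T$ (so $d(v,v)=0$). For an integer $m$, its $q$-analogue is $[m]_q=\frac{q^m-1}{q-1}$. The notation $d_q(u,v)$ stands for $[d(u,v)]_q$, the $q$-analogue of the weighted distance. In $[a_{jk}]_{1\leq j,k\leq n}$, $j$ is the row index and $k$ the column index; an empty product equals $1$. *)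

theory Defs
  imports
    "HOL-Computational_Algebra.Polynomial"
    "HOL-Computational_Algebra.Fraction_Field"
    "Jordan_Normal_Form.Determinant"
begin

text \<open>
  A finite simple undirected graph is given by its vertex set \<open>V\<close> and a set \<open>E\<close> of
  two-element subsets of \<open>V\<close>. (The trees of \<open>Graph_Theory\<close> are digraphs without directed
  cycles, which is not the notion of an undirected tree.)
\<close>

definition simple_graph :: "'v set \<Rightarrow> 'v set set \<Rightarrow> bool" where
  "simple_graph V E \<longleftrightarrow> finite V \<and> (\<forall>f\<in>E. f \<subseteq> V \<and> card f = 2)"

definition path_between :: "'v set \<Rightarrow> 'v set set \<Rightarrow> 'v \<Rightarrow> 'v \<Rightarrow> 'v list \<Rightarrow> bool" where
  "path_between V E u v p \<longleftrightarrow>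
     p \<noteq> [] \<and> hd p = u \<and> last p = v \<and> set p \<subseteq> V \<and> distinct p \<and>
     (\<forall>i. Suc i < length p \<longrightarrow> {p ! i, p ! Suc i} \<in> E)"

definition connected_graph :: "'v set \<Rightarrow> 'v set set \<Rightarrow> bool" where
  "connected_graph V E \<longleftrightarrow> V \<noteq> {} \<and> (\<forall>u\<in>V. \<forall>v\<in>V. \<exists>p. path_between V E u v p)"

text \<open>A cycle is a path on at least three vertices whose end vertices are adjacent.\<close>

definition acyclic_graph :: "'v set \<Rightarrow> 'v set set \<Rightarrow> bool" where
  "acyclic_graph V E \<longleftrightarrow>
     \<not> (\<exists>u v p. path_between V E u v p \<and> 3 \<le> length p \<and> {u, v} \<in> E)"

definition tree_graph :: "'v set \<Rightarrow> 'v set set \<Rightarrow> bool" where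
  "tree_graph V E \<longleftrightarrow> simple_graph V E \<and> connected_graph V E \<and> acyclic_graph V E"

definition is_leaf :: "'v set \<Rightarrow> 'v set set \<Rightarrow> 'v \<Rightarrow> bool" where
  "is_leaf V E v \<longleftrightarrow> v \<in> V \<and> card {f \<in> E. v \<in> f} = 1"

text \<open>Only meaningful if there is exactly one path from \<open>u\<close> to \<open>v\<close>, as in a tree.\<close>

definition wdist :: "'v set \<Rightarrow> 'v set set \<Rightarrow> ('v set \<Rightarrow> int) \<Rightarrow> 'v \<Rightarrow> 'v \<Rightarrow> int" where
  "wdist V E w u v =
     (let p = (THE p. path_between V E u v p)
      in \<Sum>i<length p - 1. w {p ! i, p ! Suc i})"

definition q_analogue :: "'k::field \<Rightarrow> int \<Rightarrow> 'k" where
  "q_analogue q m = (q powi m - 1) / (q - 1)"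

text \<open>
  The field of rational functions in three indeterminates over (the fraction field of) an
  arbitrary integral domain: \<open>q\<close> is the innermost polynomial variable, then \<open>t\<close>, then \<open>x\<close>.
\<close>

type_synonym 'a ratfun3 = "'a poly poly poly fract"

definition var_q :: "'a::idom ratfun3" where
  "var_q = Fract [:[:[:0, 1:]:]:] 1"

definition var_t :: "'a::idom ratfun3" where
  "var_t = Fract [:[:0, 1:]:] 1"

definition var_x :: "'a::idom ratfun3" where
  "var_x = Fract [:0, 1:] 1"

end

theory Submission
  imports Defs
begin

text \<open>
  If \<open>l\<close> is a leaf at \<open>u\<close>, joined by an edge of weight \<open>m\<close>, then \<open>q\<close> raised to the distance from
  \<open>l\<close> is \<open>q\<^sup>m\<close> times \<open>q\<close> raised to the distance from \<open>u\<close>, away from \<open>l\<close> itself. Subtracting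
  \<open>q\<^sup>m\<close> times the row of \<open>u\<close> from the row of \<open>l\<close> and removing leaves one by one, the full matrix of
  the \<open>q\<close>-powers of the distances of a tree has determinant \<open>\<Prod> (1 - q\<^sup>2\<^sup>w)\<close> over the edges.
  In the matrix of the theorem the column of \<open>v 1\<close> and the row of \<open>v (n + 1)\<close> can be reduced in
  the same way, where no diagonal entry interferes: the column becomes constant and absorbs \<open>t\<close>
  from all other columns, then only the corner of the row survives. What remains is the full
  matrix of the tree without these two leaves. The second formula is the first one scaled by
  \<open>1 / (q - 1)\<close>, at \<open>t = (1 - q) x + 1\<close>.
\<close>


section \<open>Paths in a graph\<close>

lemma path_between_iff:
  "path_between V E u v p \<longleftrightarrow>
     p \<noteq> [] \<and> hd p = u \<and> last p = v \<and> set p \<subseteq> V \<and> distinct p \<and>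
     successively (\<lambda>a b. {a, b} \<in> E) p"
  unfolding path_between_def successively_conv_nth by auto

lemma path_between_rev:
  "path_between V E u v p \<Longrightarrow> path_between V E v u (rev p)"
  unfolding path_between_iff by (auto simp: hd_rev last_rev insert_commute)

lemma path_between_mono:
  "path_between V E u v p \<Longrightarrow> V \<subseteq> V' \<Longrightarrow> E \<subseteq> E' \<Longrightarrow> path_between V' E' u v p"
  unfolding path_between_def by blast

lemma path_between_singleton: "u \<in> V \<Longrightarrow> path_between V E u u [u]"
  unfolding path_between_iff by auto

lemma path_between_refl_iff: "path_between V E u u p \<longleftrightarrow> u \<in> V \<and> p = [u]"
proof
  assume p: "path_between V E u u p"
  then obtain r where r: "p = u # r" unfolding path_between_iff by (cases p) auto
  with p have "r = []" unfolding path_between_iff by (cases r rule: rev_cases) auto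
  with p r show "u \<in> V \<and> p = [u]" unfolding path_between_iff by auto
qed (auto intro: path_between_singleton)

section \<open>Leaves with their neighbours, and the removal of leaves from trees\<close>

definition pendant :: "'v set \<Rightarrow> 'v set set \<Rightarrow> 'v \<Rightarrow> 'v \<Rightarrow> bool" where
  "pendant V E l u \<longleftrightarrow> l \<in> V \<and> u \<in> V \<and> l \<noteq> u \<and> {f \<in> E. l \<in> f} = {{l, u}}"

lemma pendantD:
  assumes "pendant V E l u"
  shows "l \<in> V" "u \<in> V" "l \<noteq> u" "{l, u} \<in> E" "\<And>f. f \<in> E \<Longrightarrow> l \<in> f \<Longrightarrow> f = {l, u}"
    "\<And>y. {l, y} \<in> E \<Longrightarrow> y = u" "\<And>y. {y, l} \<in> E \<Longrightarrow> y = u"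
proof -
  show "l \<in> V" "u \<in> V" "l \<noteq> u" "{l, u} \<in> E" and *: "\<And>f. f \<in> E \<Longrightarrow> l \<in> f \<Longrightarrow> f = {l, u}"
    using assms unfolding pendant_def by auto
  show "\<And>y. {l, y} \<in> E \<Longrightarrow> y = u" "\<And>y. {y, l} \<in> E \<Longrightarrow> y = u"
    using * by (metis doubleton_eq_iff insertI1, metis doubleton_eq_iff insertI1 insertI2)
qed

lemma leaf_pendant:
  assumes "simple_graph V E" "is_leaf V E l" "f \<in> E" "l \<in> f"
  shows "\<exists>u. pendant V E l u \<and> f = {l, u}"
proof -
  obtain g where g: "{f \<in> E. l \<in> f} = {g}"
    using assms(2) unfolding is_leaf_def by (meson card_1_singletonE)
  have f: "f \<subseteq> V" "card f = 2" using assms unfolding simple_graph_def by auto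
  then obtain a b where "f = {a, b}" "a \<noteq> b" by (auto simp: card_2_iff)
  with \<open>l \<in> f\<close> obtain u where u: "f = {l, u}" "l \<noteq> u" by (metis doubleton_eq_iff insertE singletonD)
  have "f \<in> {f \<in> E. l \<in> f}" using assms(3,4) by simp
  then have "f = g" unfolding g by simp
  have "pendant V E l u"
    unfolding pendant_def g \<open>f = g\<close>[symmetric] using f(1) u by simp
  then show ?thesis using u by blast
qed

text \<open>A path passing through \<open>l\<close> in its interior would use two distinct
  neighbours of \<open>l\<close>, but \<open>u\<close> is the only one.\<close>

lemma pendant_avoid:
  assumes l: "pendant V E l u" and p: "path_between V E a b p" and "a \<noteq> l" "b \<noteq> l"
  shows "path_between (V - {l}) (E - {{l, u}}) a b p"
proof -
  have nl: "l \<notin> set p"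
  proof
    assume "l \<in> set p"
    then obtain xs ys where ps: "p = xs @ l # ys" by (auto simp: in_set_conv_decomp)
    obtain xs' x where xs: "xs = xs' @ [x]"
      using p ps \<open>a \<noteq> l\<close> unfolding path_between_iff by (cases xs rule: rev_cases) auto
    obtain y ys' where ys: "ys = y # ys'"
      using p ps \<open>b \<noteq> l\<close> unfolding path_between_iff by (cases ys) auto
    have "{x, l} \<in> E" "{l, y} \<in> E" "x \<noteq> y"
      using p unfolding ps xs ys path_between_iff
      by (auto simp: successively_append_iff successively_Cons)
    then show False using pendantD[OF l] by metis
  qed
  have "{p ! i, p ! Suc i} \<noteq> {l, u}" if "Suc i < length p" for i
    using that nl nth_mem[of i p] nth_mem[of "Suc i" p] by (auto simp: doubleton_eq_iff)
  then show ?thesis using p nl unfolding path_between_def by auto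
qed

lemma pendant_path:
  assumes l: "pendant V E l u" and p: "path_between V E l b p" and "b \<noteq> l"
  shows "\<exists>p'. p = l # p' \<and> path_between (V - {l}) (E - {{l, u}}) u b p'"
proof -
  obtain p' where p': "p = l # p'" using p unfolding path_between_iff by (cases p) auto
  obtain y r where r: "p' = y # r" using p p' \<open>b \<noteq> l\<close> unfolding path_between_iff by (cases p') auto
  have "y = u" using p pendantD(6)[OF l] unfolding path_between_iff p' r by auto
  then have "path_between V E u b p'" using p unfolding path_between_iff p' r by auto
  then show ?thesis using pendant_avoid[OF l] pendantD(3)[OF l] p' \<open>b \<noteq> l\<close> by blast
qed

lemma tree_graph_remove_pendant:
  assumes T: "tree_graph V E" and l: "pendant V E l u"
  shows "tree_graph (V - {l}) (E - {{l, u}})"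
proof -
  note d = pendantD[OF l]
  have "simple_graph (V - {l}) (E - {{l, u}})"
    using T d unfolding tree_graph_def simple_graph_def by blast
  moreover have "connected_graph (V - {l}) (E - {{l, u}})"
    using T pendant_avoid[OF l] d(2,3) unfolding tree_graph_def connected_graph_def
    by (metis Diff_iff empty_iff insert_iff)
  moreover have "acyclic_graph (V - {l}) (E - {{l, u}})"
    using T path_between_mono[of "V - {l}" "E - {{l, u}}" _ _ _ V E]
    unfolding tree_graph_def acyclic_graph_def by blast
  ultimately show ?thesis unfolding tree_graph_def by blast
qed

text \<open>The first vertex \<open>l\<close> of a longest path is a leaf: a further neighbour off
  the path would prolong it, and one on the path would close a cycle.\<close>

lemma tree_graph_has_pendant:
  assumes T: "tree_graph V E" and c: "card V \<ge> 2"
  shows "\<exists>l u. pendant V E l u"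
proof -
  have fin: "finite V" and conn: "connected_graph V E" and acyc: "acyclic_graph V E"
    using T unfolding tree_graph_def simple_graph_def by auto
  define P where "P p \<longleftrightarrow> (\<exists>u v. path_between V E u v p)" for p
  obtain a b where ab: "a \<in> V" "b \<in> V" "a \<noteq> b"
    using c by (meson card_2_iff' obtain_subset_with_card_n subsetD)
  then obtain p0 where p0: "path_between V E a b p0" using conn unfolding connected_graph_def by blast
  have len0: "length p0 \<ge> 2"
    using p0 ab(3) unfolding path_between_iff by (cases p0 rule: remdups_adj.cases) auto
  have "P p \<Longrightarrow> length p < Suc (card V)" for p
    unfolding P_def path_between_iff
    by (metis card_mono[OF fin] distinct_card le_imp_less_Suc)
  then obtain p where p: "P p" and mx: "\<And>q. P q \<Longrightarrow> length q \<le> length p"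
    using ex_has_greatest_nat[of P p0 length "Suc (card V)"] p0 unfolding P_def by (metis less_imp_le)
  have "length p \<ge> 2" using mx[of p0] p0 len0 unfolding P_def by fastforce
  then obtain l u r where r: "p = l # u # r" by (cases p rule: remdups_adj.cases) auto
  obtain b' where b': "path_between V E l b' p"
    using p r unfolding P_def path_between_iff by auto
  have lu: "{l, u} \<in> E" "l \<noteq> u" "l \<in> V" "u \<in> V" using b' unfolding path_between_iff r by auto
  have "f = {l, u}" if f: "f \<in> E" "l \<in> f" for f
  proof -
    have "f \<subseteq> V" "card f = 2" using T f unfolding tree_graph_def simple_graph_def by auto
    then obtain z where z: "f = {l, z}" "z \<noteq> l" "z \<in> V" using f
      by (auto simp: card_2_iff)
    have "z = u"
    proof (rule ccontr)
      assume zu: "z \<noteq> u"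
      show False
      proof (cases "z \<in> set p")
        case False
        then have "path_between V E z b' (z # p)"
          using b' z f unfolding path_between_iff r by (auto simp: insert_commute)
        then show False using mx[of "z # p"] unfolding P_def by auto
      next
        case True
        then have "z \<in> set r" using z zu r by auto
        then obtain xs ys where xy: "r = xs @ z # ys" by (auto simp: in_set_conv_decomp)
        have "path_between V E l z (l # u # xs @ [z])"
          using b' unfolding path_between_iff r xy
          by (auto simp: successively_append_iff successively_Cons hd_append)
        then show False using acyc f z unfolding acyclic_graph_def by force
      qed
    qed
    then show ?thesis using z by simp
  qed
  then show ?thesis using lu unfolding pendant_def by blast
qed

lemma tree_graph_single:
  assumes "tree_graph V E" "card V = 1"
  shows "E = {}"
proof -
  have "card f \<le> 1 \<and> card f = 2" if "f \<in> E" for f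
    using assms that card_mono[of V f] unfolding tree_graph_def simple_graph_def by auto
  then show ?thesis by fastforce
qed

text \<open>Induction by removing a leaf. A path that ends at the leaf has its edge there forced;
  any other path avoids the leaf. In both cases the rest lies in a smaller tree.\<close>

lemma tree_path_unique:
  assumes "tree_graph V E" "path_between V E a b p" "path_between V E a b p'"
  shows "p = p'"
  using assms
proof (induction "card V" arbitrary: V E a b p p' rule: less_induct)
  case less
  have fin: "finite V" using less.prems unfolding tree_graph_def simple_graph_def by auto
  have ab: "a \<in> V" "b \<in> V" using less.prems(2) unfolding path_between_iff by auto
  show ?case
  proof (cases "a = b")
    case True
    then show ?thesis using less.prems by (simp add: path_between_refl_iff)
  next
    case False
    then have "card {a, b} \<le> card V" using ab fin by (intro card_mono) auto
    then obtain l u where l: "pendant V E l u"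
      using tree_graph_has_pendant[OF less.prems(1)] False by auto
    note IH = less.hyps[OF _ tree_graph_remove_pendant[OF less.prems(1) l]]
    have c: "card (V - {l}) < card V" using fin pendantD[OF l] by (meson card_Diff1_less)
    consider "a = l" | "b = l" | "a \<noteq> l" "b \<noteq> l" by blast
    then show ?thesis
    proof cases
      case 1
      then show ?thesis
        using pendant_path[OF l] less.prems(2,3) False IH[OF c] by metis
    next
      case 2
      then have "rev p = rev p'"
        using pendant_path[OF l] path_between_rev less.prems(2,3) False IH[OF c] by metis
      then show ?thesis by simp
    next
      case 3
      then show ?thesis using pendant_avoid[OF l] less.prems(2,3) IH[OF c] by metis
    qed
  qed
qed

section \<open>Weighted distances in trees\<close>

lemma tree_path_exists:
  assumes "tree_graph V E" "a \<in> V" "b \<in> V"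
  obtains p where "path_between V E a b p"
  using assms unfolding tree_graph_def connected_graph_def by blast

text \<open>Uniqueness resolves the \<open>THE\<close> in \<open>wdist\<close>, so a distance can be
  read off from whichever path is at hand.\<close>

lemma wdist_path:
  assumes "tree_graph V E" "path_between V E a b p"
  shows "wdist V E w a b = (\<Sum>i<length p - 1. w {p ! i, p ! Suc i})"
proof -
  have "(THE p. path_between V E a b p) = p"
    using assms by (auto intro: the_equality tree_path_unique)
  then show ?thesis unfolding wdist_def by simp
qed

lemma wdist_refl:
  assumes "u \<in> V"
  shows "wdist V E w u u = 0"
proof -
  have "path_between V E u u = (\<lambda>p. p = [u])" using assms by (auto simp: path_between_refl_iff)
  then show ?thesis unfolding wdist_def by simp
qed

lemma wdist_commute:
  assumes T: "tree_graph V E" and "a \<in> V" "b \<in> V"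
  shows "wdist V E w a b = wdist V E w b a"
proof -
  obtain p where p: "path_between V E a b p" using tree_path_exists assms by metis
  have "(\<Sum>i<length p - 1. w {p ! i, p ! Suc i}) = (\<Sum>i<length p - 1. w {rev p ! i, rev p ! Suc i})"
    \<comment> \<open>The edge at position \<open>i\<close> of \<open>rev p\<close> is the edge at
      position \<open>length p - 2 - i\<close> of \<open>p\<close>.\<close>
    by (rule sum.reindex_bij_witness[where i = "\<lambda>i. length p - 2 - i" and j = "\<lambda>i. length p - 2 - i"])
       (auto simp: rev_nth insert_commute Suc_diff_Suc numeral_2_eq_2)
  then show ?thesis using wdist_path[OF T p] wdist_path[OF T path_between_rev[OF p]] by simp
qed

lemma wdist_remove_pendant:
  assumes T: "tree_graph V E" and l: "pendant V E l u" and ab: "a \<in> V - {l}" "b \<in> V - {l}"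
  shows "wdist (V - {l}) (E - {{l, u}}) w a b = wdist V E w a b"
proof -
  have T': "tree_graph (V - {l}) (E - {{l, u}})" using tree_graph_remove_pendant[OF T l] .
  obtain p where p: "path_between (V - {l}) (E - {{l, u}}) a b p"
    using tree_path_exists[OF T' ab] .
  have "path_between V E a b p" using path_between_mono[OF p] by blast
  then show ?thesis using wdist_path[OF T] wdist_path[OF T' p] by metis
qed

lemma wdist_pendant:
  assumes T: "tree_graph V E" and l: "pendant V E l u" and b: "b \<in> V" "b \<noteq> l"
  shows "wdist V E w l b = w {l, u} + wdist V E w u b"
proof -
  obtain p where p: "path_between V E l b p" using tree_path_exists[OF T pendantD(1)[OF l] b(1)] .
  obtain p' where p': "p = l # p'" "path_between (V - {l}) (E - {{l, u}}) u b p'"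
    using pendant_path[OF l p b(2)] by blast
  have P: "path_between V E u b p'" using path_between_mono[OF p'(2)] by blast
  obtain r where r: "p' = u # r" using P unfolding path_between_iff by (cases p') auto
  show ?thesis unfolding wdist_path[OF T p] wdist_path[OF T P] unfolding p' r
    by (simp add: sum.lessThan_Suc_shift del: sum.lessThan_Suc)
qed


section \<open>The determinant of the full matrix of a tree\<close>

lemma det_row_single_entry:
  fixes A :: "'a::comm_ring_1 mat"
  assumes A: "A \<in> carrier_mat n n" and ij: "i < n" "j < n"
    and z: "\<And>k. k < n \<Longrightarrow> k \<noteq> j \<Longrightarrow> A $$ (i, k) = 0"
  shows "det A = A $$ (i, j) * ((-1) ^ (i + j) * det (mat_delete A i j))"
proof -
  have "det A = (\<Sum>k<n. A $$ (i, k) * cofactor A i k)"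
    by (rule laplace_expansion_row[OF A ij(1)])
  also have "\<dots> = (\<Sum>k\<in>{j}. A $$ (i, k) * cofactor A i k)"
    using ij z by (intro sum.mono_neutral_right) auto
  finally show ?thesis by (simp add: cofactor_def)
qed

lemma powi_wdist_pendant:
  fixes q :: "'k::field"
  assumes "q \<noteq> 0" "tree_graph V E" "pendant V E l u" "b \<in> V" "b \<noteq> l"
  shows "q powi wdist V E w l b = q powi w {l, u} * q powi wdist V E w u b"
    and "q powi wdist V E w b l = q powi w {l, u} * q powi wdist V E w b u"
proof -
  show *: "q powi wdist V E w l b = q powi w {l, u} * q powi wdist V E w u b"
    using assms by (simp add: wdist_pendant power_int_add)
  show "q powi wdist V E w b l = q powi w {l, u} * q powi wdist V E w b u"
    using * assms wdist_commute[OF assms(2)] pendantD[OF assms(3)] by metis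
qed

lemma det_tree_powi:
  fixes q :: "'k::field"
  assumes "q \<noteq> 0" "tree_graph V E" "bij_betw v {..<m} V"
  shows "det (mat m m (\<lambda>(j, k). q powi wdist V E w (v j) (v k))) = (\<Prod>f\<in>E. 1 - (q powi w f)\<^sup>2)"
  using assms(2,3)
proof (induction m arbitrary: V E v)
  case 0
  then show ?case by (auto simp: bij_betw_def tree_graph_def connected_graph_def)
next
  case (Suc m)
  note T = \<open>tree_graph V E\<close> and v = \<open>bij_betw v {..<Suc m} V\<close>
  let ?A = "mat (Suc m) (Suc m) (\<lambda>(j, k). q powi wdist V E w (v j) (v k))"
  have card: "card V = Suc m" using bij_betw_same_card[OF v] by simp
  have vV: "v i \<in> V" if "i < Suc m" for i using v that by (auto simp: bij_betw_def)
  have inj: "v i = v j \<longleftrightarrow> i = j" if "i < Suc m" "j < Suc m" for i j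
    using v that unfolding bij_betw_def inj_on_def by auto
  show ?case
  proof (cases "m = 0")
    case True
    then have "E = {}" using tree_graph_single[OF T] card by simp
    moreover have "det ?A = 1"
      using True vV[of 0] by (subst det_single) (auto simp: wdist_refl)
    ultimately show ?thesis by simp
  next
    case False
    then obtain l u where l: "pendant V E l u" using tree_graph_has_pendant[OF T] card by auto
    note d = pendantD[OF l]
    obtain i where i: "i < Suc m" "v i = l" using v d(1) by (auto simp: bij_betw_def)
    obtain i' where i': "i' < Suc m" "v i' = u" using v d(2) by (auto simp: bij_betw_def)
    have ii': "i \<noteq> i'" using i i' d(3) by auto
    define x where "x = q powi w {l, u}"
    \<comment> \<open>The pendant vertex may sit anywhere in the enumeration. Skipping its index
      \<open>i\<close> renumbers the others exactly as \<open>mat_delete\<close> does.\<close>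
    define v' where "v' k = v (if k < i then k else Suc k)" for k
    let ?V = "V - {l}" and ?E = "E - {{l, u}}"
    define B where "B = addrow (- x) i i' ?A"
    have T': "tree_graph ?V ?E" using tree_graph_remove_pendant[OF T l] .
    have v': "bij_betw v' {..<m} ?V"
    proof -
      have "bij_betw (\<lambda>k. if k < i then k else Suc k) {..<m} ({..<Suc m} - {i})"
        using i(1)
        by (intro bij_betw_byWitness[where f' = "\<lambda>k. if k < i then k else k - 1"]) auto
      moreover have "bij_betw v ({..<Suc m} - {i}) ?V"
        using bij_betw_DiffI[OF v, of "{i}" "{l}"] i d(1) by (simp add: bij_betw_def)
      ultimately show ?thesis using bij_betw_trans unfolding v'_def comp_def by fastforce
    qed
    have v'V: "v' j \<in> ?V" if "j < m" for j using v' that by (auto simp: bij_betw_def)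
    \<comment> \<open>On the diagonal, \<open>l\<close> has distance 0 to itself and the row of
      \<open>u\<close> contributes \<open>x\<close>, which leaves \<open>1 - x * x\<close>;
      elsewhere the two rows are proportional.\<close>
    have row: "B $$ (i, k) = (if k = i then 1 - x\<^sup>2 else 0)" if k: "k < Suc m" for k
    proof (cases "k = i")
      case True
      have "q powi wdist V E w u l = x"
        using powi_wdist_pendant(2)[OF assms(1) T l d(2)] d unfolding x_def
        by (metis mult.right_neutral power_int_0_right wdist_refl)
      then show ?thesis using True i i' d(1) by (simp add: wdist_refl power2_eq_square B_def)
    next
      case False
      then have "v k \<noteq> l" using inj[of k i] i k by auto
      then show ?thesis
        using False i i' k powi_wdist_pendant(1)[OF assms(1) T l vV[OF k]] by (simp add: x_def B_def)
    qed
    have "mat_delete B i i = mat m m (\<lambda>(j, k). q powi wdist ?V ?E w (v' j) (v' k))"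
      using wdist_remove_pendant[OF T l v'V v'V]
      by (intro eq_matI) (auto simp: mat_delete_def v'_def B_def)
    moreover have "B \<in> carrier_mat (Suc m) (Suc m)" by (simp add: B_def)
    then have "det B = (1 - x\<^sup>2) * det (mat_delete B i i)"
      using det_row_single_entry[of B "Suc m" i i] row i by simp
    moreover have "det B = det ?A"
      unfolding B_def using i i' ii' by (intro det_addrow) auto
    moreover have "finite E"
      using T unfolding tree_graph_def simple_graph_def by (meson Pow_iff finite_Pow_iff finite_subset subsetI)
    ultimately show ?thesis
      using Suc.IH[OF T' v'] d(4) by (simp add: prod.remove[of E "{l, u}"] x_def)
  qed
qed

section \<open>The matrix shifted by \<open>t\<close>, with one leaf missing among the rows and
  another among the columns\<close>

lemma pendant_remove_pendant:
  assumes l: "pendant V E l u" and l': "pendant V E l' u'" and ne: "{l, u} \<noteq> {l', u'}"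
  shows "pendant (V - {l}) (E - {{l, u}}) l' u'"
proof -
  note d = pendantD[OF l] and d' = pendantD[OF l']
  \<comment> \<open>The only edge at \<open>l\<close> is \<open>{l, u}\<close>, which differs from
    \<open>{l', u'}\<close>.\<close>
  have "l \<notin> {l', u'}" using d(5)[OF d'(4)] ne by blast
  then show ?thesis using l' ne unfolding pendant_def by auto
qed

text \<open>Stated for arbitrary field elements \<open>q\<close> and \<open>t\<close>, so that it
  serves both formulas of the theorem with different values of \<open>t\<close>.\<close>

lemma det_tree_powi_minus:
  fixes q t :: "'k::field"
  assumes q: "q \<noteq> 0" and n: "n > 1" and T: "tree_graph V E"
    and v: "bij_betw v {1..n+1} V" and e: "bij_betw e {1..n} E"
    and leaves: "is_leaf V E (v 1)" "is_leaf V E (v (n + 1))"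
    and inc: "v 1 \<in> e 1" "v (n + 1) \<in> e n"
  shows "det (mat n n (\<lambda>(j, k). q powi wdist V E w (v (j + 2)) (v (k + 1)) - t))
    = t * (q powi w (e 1) - 1) * (q powi w (e n) - 1) * (\<Prod>i\<in>{1<..<n}. q powi (2 * w (e i)) - 1)"
proof -
  have inj: "v i = v j \<longleftrightarrow> i = j" if "i \<in> {1..n+1}" "j \<in> {1..n+1}" for i j
    using v that unfolding bij_betw_def inj_on_def by blast
  have vV: "v i \<in> V" if "i \<in> {1..n+1}" for i using v that by (auto simp: bij_betw_def)
  have eE: "e i \<in> E" if "i \<in> {1..n}" for i using e that by (auto simp: bij_betw_def)
  have sg: "simple_graph V E" using T unfolding tree_graph_def by simp
  obtain a where a: "pendant V E (v 1) a" and e1: "e 1 = {v 1, a}"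
    using leaf_pendant[OF sg leaves(1) eE[of 1] inc(1)] n by auto
  obtain b where b: "pendant V E (v (n + 1)) b" and en: "e n = {v (n + 1), b}"
    using leaf_pendant[OF sg leaves(2) eE[of n] inc(2)] n by auto
  note da = pendantD[OF a] and db = pendantD[OF b]
  have ne: "e 1 \<noteq> e n" using e n by (auto simp: bij_betw_def dest: inj_onD)
  \<comment> \<open>Otherwise one edge would meet both leaves and \<open>e 1 = e n\<close>. Hence
    \<open>a\<close> and \<open>b\<close> are among \<open>v 2\<close>, ..., \<open>v n\<close>, so
    the matrix has a column for \<open>a\<close> other than the first and a row for \<open>b\<close>
    other than the last.\<close>
  have "a \<noteq> v (n + 1)" "b \<noteq> v 1"
    using da(4,5) db(4,5) ne e1 en by blast+
  moreover obtain ja where *: "ja \<in> {1..n+1}" "v ja = a" using v da(2) unfolding bij_betw_def by blast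
  moreover obtain jb where **: "jb \<in> {1..n+1}" "v jb = b" using v db(2) unfolding bij_betw_def by blast
  ultimately have "ja \<notin> {1, n + 1}" "jb \<notin> {1, n + 1}" using da(3) db(3) by auto
  with * ** have ja: "ja \<in> {2..n}" "v ja = a" and jb: "jb \<in> {2..n}" "v jb = b" by auto

  define x where "x = q powi w (e 1)"
  define y where "y = q powi w (e n)"
  define M where "M i j = q powi wdist V E w (v i) (v j)" for i j
  \<comment> \<open>There is no row for \<open>v 1\<close> and no column for
    \<open>v (n + 1)\<close>, so the proportionality holds along the whole column here and along the
    whole row in \<open>My\<close>.\<close>
  have Mx: "M i 1 = x * M i ja" if "i \<in> {2..n+1}" for i
    using powi_wdist_pendant(2)[OF q T a, of "v i"] vV[of i] inj[of i 1] that ja e1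
    unfolding M_def x_def by simp
  have My: "M (n + 1) j = y * M jb j" if "j \<in> {1..n}" for j
    using powi_wdist_pendant(1)[OF q T b, of "v j"] vV[of j] inj[of j "n + 1"] that jb en
    unfolding M_def y_def by simp

  txt \<open>After reducing the first column of \<open>A\<close> to a constant, that column absorbs the shift by \<open>- t\<close>
    in all the others; the factor \<open>U\<close> records both this and the scalar \<open>1 - x\<close>.\<close>

  define A where "A = mat n n (\<lambda>(j, k). M (j + 2) (k + 1) - t)"
  define B where "B = mat n n (\<lambda>(j, k). if k = 0 then - t else M (j + 2) (k + 1))"
  define U where "U = mat n n (\<lambda>(j, k). if j = k then if j = 0 then 1 - x else 1
    else if j = 0 then 1 else (0::'k))"
  define C where "C = addrow (- y) (n - 1) (jb - 2) B"

  \<comment> \<open>Column 0 on the left is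
    \<open>M i 1 - t - x * (M i ja - t) = - t * (1 - x)\<close>. For \<open>k > 0\<close>, column
    \<open>k\<close> of \<open>U\<close> has ones in rows 0 and \<open>k\<close> only, which adds
    \<open>- t\<close> to column \<open>k\<close> of \<open>B\<close>.\<close>
  have "addcol (- x) 0 (ja - 1) A = B * U"
  proof (rule eq_matI)
    fix i k assume "i < dim_row (B * U)" "k < dim_col (B * U)"
    then have i: "i < n" and k: "k < n" by (auto simp: B_def U_def)
    have BU: "(B * U) $$ (i, k) = (\<Sum>j\<in>{0..<n}. B $$ (i, j) * U $$ (j, k))"
      using i k by (simp add: scalar_prod_def B_def U_def)
    also have "\<dots> = (\<Sum>j\<in>{0, k}. B $$ (i, j) * U $$ (j, k))"
      using i k by (intro sum.mono_neutral_right) (auto simp: U_def)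
    also have "\<dots> = addcol (- x) 0 (ja - 1) A $$ (i, k)"
      using i k n ja Mx[of "i + 2"]
      by (cases "k = 0") (auto simp: A_def B_def U_def algebra_simps)
    finally show "addcol (- x) 0 (ja - 1) A $$ (i, k) = (B * U) $$ (i, k)" by simp
  qed (auto simp: A_def B_def U_def)
  moreover have "det (addcol (- x) 0 (ja - 1) A) = det A"
    using ja n by (intro det_addcol[of _ n]) (auto simp: A_def)
  ultimately have "det A = det B * det U"
    using det_mult[of B n U] by (simp add: B_def U_def)
  moreover have "det U = 1 - x"
  proof -
    have "det U = prod_list (diag_mat U)"
      by (rule det_upper_triangular[of _ n]) (auto simp: U_def)
    also have "\<dots> = (\<Prod>i\<in>{0..<n}. if i = 0 then 1 - x else 1)"
      unfolding prod_list_diag_prod by (intro prod.cong) (auto simp: U_def)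
    finally show ?thesis using n by simp
  qed
  moreover have "det B = det C"
    unfolding C_def using jb n by (intro det_addrow[of _ n, symmetric]) (auto simp: B_def)
  moreover have "det C = - t * (1 - y) * ((-1) ^ (n - 1) * det (mat_delete C (n - 1) 0))"
  proof -
    \<comment> \<open>Row \<open>j\<close> belongs to \<open>v (j + 2)\<close>, so row
      \<open>jb - 2\<close> is that of \<open>b\<close>. In column 0 two entries \<open>- t\<close>
      combine to \<open>- t * (1 - y)\<close>; the other columns cancel by
      \<open>My\<close>.\<close>
    have jb': "jb - 2 < n" "Suc (Suc (jb - 2)) = jb" using jb by auto
    then have "C $$ (n - 1, 0) = - t * (1 - y)"
      using n jb by (simp add: C_def B_def algebra_simps)
    moreover have "C $$ (n - 1, k) = 0" if "k < n" "k \<noteq> 0" for k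
      using that n jb My[of "k + 1"] jb' by (simp add: C_def B_def)
    ultimately show ?thesis
      using det_row_single_entry[of C n "n - 1" 0] n by (simp add: C_def B_def)
  qed
  moreover have "det (mat_delete C (n - 1) 0) = (-1) ^ n * (\<Prod>i\<in>{1<..<n}. q powi (2 * w (e i)) - 1)"
  proof -
    let ?V1 = "V - {v 1}" and ?E1 = "E - {e 1}"
    let ?V2 = "?V1 - {v (n + 1)}" and ?E2 = "?E1 - {e n}"
    have T1: "tree_graph ?V1 ?E1" using tree_graph_remove_pendant[OF T a] e1 by simp
    have b1: "pendant ?V1 ?E1 (v (n + 1)) b"
      using pendant_remove_pendant[OF a b] ne e1 en by simp
    have T2: "tree_graph ?V2 ?E2" using tree_graph_remove_pendant[OF T1 b1] en by simp
    have W: "wdist ?V2 ?E2 w c d = wdist V E w c d" if "c \<in> ?V2" "d \<in> ?V2" for c d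
      using wdist_remove_pendant[OF T1 b1, of c d w] wdist_remove_pendant[OF T a, of c d w] that e1 en
      by simp
    have v2: "bij_betw (\<lambda>i. v (i + 2)) {..<n - 1} ?V2"
    proof -
      have 1: "bij_betw v ({1..n+1} - {1, n+1}) (V - {v 1, v (n + 1)})"
        using bij_betw_DiffI[OF v, of "{1, n + 1}" "{v 1, v (n + 1)}"] da(1) db(1) n inj[of 1 "n + 1"]
        by (simp add: bij_betw_def)
      have 2: "bij_betw (\<lambda>i. i + 2) {..<n - 1} ({1..n+1} - {1, n+1})"
        by (intro bij_betw_byWitness[where f' = "\<lambda>i. i - 2"]) auto
      have "V - {v 1, v (n + 1)} = ?V2" by auto
      then show ?thesis using bij_betw_trans[OF 2 1] by (simp only: comp_def)
    qed
    have v2V: "v (i + 2) \<in> ?V2" if "i < n - 1" for i using v2 that by (auto simp: bij_betw_def)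
    \<comment> \<open>Without the last row and the first column, rows and columns both run over
      \<open>v 2\<close>, ..., \<open>v n\<close>: the full matrix of the tree without the two
      leaves.\<close>
    have "mat_delete C (n - 1) 0
        = mat (n - 1) (n - 1) (\<lambda>(j, k). q powi wdist ?V2 ?E2 w (v (j + 2)) (v (k + 2)))"
      using W[OF v2V v2V] by (intro eq_matI) (auto simp: mat_delete_def C_def B_def M_def)
    then have "det (mat_delete C (n - 1) 0) = (\<Prod>f\<in>?E2. 1 - (q powi w f)\<^sup>2)"
      using det_tree_powi[OF q T2 v2] by simp
    also have "?E2 = e ` {1<..<n}"
    proof -
      have "?E2 = e ` {1..n} - e ` {1, n}" using e by (auto simp: bij_betw_def)
      also have "\<dots> = e ` ({1..n} - {1, n})"
        using e n by (intro inj_on_image_set_diff[of e "{1..n}", symmetric]) (auto simp: bij_betw_def)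
      also have "{1..n} - {1, n} = {1<..<n}" by auto
      finally show ?thesis .
    qed
    also have "(\<Prod>f\<in>e ` {1<..<n}. 1 - (q powi w f)\<^sup>2) = (\<Prod>i\<in>{1<..<n}. 1 - (q powi w (e i))\<^sup>2)"
      by (subst prod.reindex, rule inj_on_subset[OF bij_betw_imp_inj_on[OF e]]) auto
    also have "\<dots> = (\<Prod>i\<in>{1<..<n}. (- 1) * (q powi (2 * w (e i)) - 1))"
    proof -
      have "q powi (2 * m) = (q powi m)\<^sup>2" for m
        using power_int_add[of q m m] q by (simp add: power2_eq_square)
      then show ?thesis by simp
    qed
    also have "\<dots> = (- 1) ^ card {1<..<n} * (\<Prod>i\<in>{1<..<n}. q powi (2 * w (e i)) - 1)"
      unfolding prod.distrib by (simp only: prod_constant)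
    \<comment> \<open>There are \<open>n - 2\<close> inner edges, and \<open>n - 2\<close> has the
      parity of \<open>n\<close>.\<close>
    also have "(- 1) ^ card {1<..<n} = ((- 1) ^ n :: 'k)"
      using n by (simp add: minus_one_power_iff)
    finally show ?thesis .
  qed
  ultimately have "det A = t * (1 - x) * (1 - y) * - ((-1) ^ (n - 1) * (-1) ^ n)
      * (\<Prod>i\<in>{1<..<n}. q powi (2 * w (e i)) - 1)"
    by (simp add: mult_ac)
  also have "- ((-1) ^ (n - 1) * (-1) ^ n) = (1 :: 'k)"
    using n by (cases n) (auto simp flip: power_add)
  finally show ?thesis by (simp add: A_def M_def x_def y_def algebra_simps)
qed

(* Matrices are indexed from 0: the entry (j, k) below is the entry in row j + 1 and
   column k + 1, which involves the vertices v (j + 2) and v (k + 1). *)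
theorem theorem1p2:
  fixes n :: nat
    and V :: "'v set" and E :: "'v set set"
    and v :: "nat \<Rightarrow> 'v" and e :: "nat \<Rightarrow> 'v set"
    and w :: "'v set \<Rightarrow> int"
  assumes "n > 1"
    and "tree_graph V E"
    and "bij_betw v {1..n+1} V"
    and "bij_betw e {1..n} E"
    and "is_leaf V E (v 1)" and "is_leaf V E (v (n + 1))"
    and "v 1 \<in> e 1" and "v (n + 1) \<in> e n"
  shows
    "det (mat n n (\<lambda>(j, k). (var_q :: 'a::idom ratfun3) powi wdist V E w (v (j + 2)) (v (k + 1)) - var_t))
       = var_t * (var_q powi w (e 1) - 1) * (var_q powi w (e n) - 1)
           * (\<Prod>i\<in>{1<..<n}. var_q powi (2 * w (e i)) - 1)
     \<and>
     det (mat n n (\<lambda>(j, k). (var_x :: 'a::idom ratfun3) + q_analogue var_q (wdist V E w (v (j + 2)) (v (k + 1)))))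
       = ((1 - var_q) * var_x + 1) * q_analogue var_q (w (e 1)) * q_analogue var_q (w (e n))
           * (\<Prod>i\<in>{1<..<n}. q_analogue var_q (2 * w (e i)))"
proof
  let ?q = "var_q :: 'a ratfun3" and ?x = "var_x :: 'a ratfun3"
  let ?D = "\<lambda>j k. wdist V E w (v (j + 2)) (v (k + 1))"
  have q: "?q \<noteq> 0" "?q \<noteq> 1"
    unfolding var_q_def Zero_fract_def One_fract_def by (simp_all add: eq_fract one_pCons)
  note main = det_tree_powi_minus[OF q(1) assms]
  show "det (mat n n (\<lambda>(j, k). ?q powi ?D j k - var_t))
       = var_t * (?q powi w (e 1) - 1) * (?q powi w (e n) - 1)
           * (\<Prod>i\<in>{1<..<n}. ?q powi (2 * w (e i)) - 1)"
    by (rule main)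
  define t where "t = (1 - ?q) * ?x + 1"
  define c where "c = inverse (?q - 1)"
  have qa: "q_analogue ?q m = c * (?q powi m - 1)" for m
    by (simp add: q_analogue_def c_def divide_inverse mult.commute)
  have "c * (?q - 1) = 1" using q(2) by (simp add: c_def)
  then have "?x = c * (?q - 1) * ?x" by simp
  also have "\<dots> = c * (1 - t)" unfolding t_def by (simp add: algebra_simps)
  finally have x: "?x = c * (1 - t)" .
  \<comment> \<open>Since \<open>c * (1 - t)\<close> is the variable \<open>x\<close>, splitting
    \<open>q^m - t\<close> as \<open>(q^m - 1) + (1 - t)\<close> and multiplying by \<open>c\<close>
    gives the q-analogue of \<open>m\<close> plus \<open>x\<close>.\<close>
  have "mat n n (\<lambda>(j, k). ?x + q_analogue ?q (?D j k)) = c \<cdot>\<^sub>m mat n n (\<lambda>(j, k). ?q powi ?D j k - t)"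
    by (intro eq_matI) (auto simp: qa x algebra_simps)
  then have "det (mat n n (\<lambda>(j, k). ?x + q_analogue ?q (?D j k)))
      = c ^ n * (t * (?q powi w (e 1) - 1) * (?q powi w (e n) - 1)
           * (\<Prod>i\<in>{1<..<n}. ?q powi (2 * w (e i)) - 1))"
    by (simp only: main det_smult dim_col_mat)
  \<comment> \<open>One factor \<open>c\<close> goes to each of the two leaf edges and one to each
    inner edge; \<open>t\<close> takes none.\<close>
  moreover have "c ^ n = c * c * c ^ card {1<..<n}"
  proof -
    have "n = Suc (Suc (card {1<..<n}))" using \<open>n > 1\<close> by simp
    then have "c ^ n = c ^ Suc (Suc (card {1<..<n}))" by (rule arg_cong)
    then show ?thesis by (simp only: power_Suc mult.assoc)
  qed
  ultimately show "det (mat n n (\<lambda>(j, k). ?x + q_analogue ?q (?D j k)))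
       = ((1 - ?q) * ?x + 1) * q_analogue ?q (w (e 1)) * q_analogue ?q (w (e n))
           * (\<Prod>i\<in>{1<..<n}. q_analogue ?q (2 * w (e i)))"
    unfolding qa t_def prod.distrib prod_constant by (simp only: ac_simps)
qed

end
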